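(* Let $G$ be a group, $(H,f_G^H)$ a $G$-group, $i\in\{1,2\}$ and $P\in Spec^i_G(H)$. The stalk of the structural sheaf $O^i_H$ at $P$ is a quotient of $H/rad^i_G(P)$.
   Context: A $G$-group is a group $H$ together with a homomorphism $f_G^H:G\to H$. For $x\in H$, $G(x)$ is the subgroup of $H$ generated by $\{f_G^H(g)xf_G^H(g)^{-1}: g\in G\}$. For subgroups $L,L'$, $[L,L']$ is the subgroup generated by the commutators $ll'l^{-1}l'^{-1}$, $l\in L,l'\in L'$. An ideal of $H$ is a normal subgroup distinct from $H$. An ideal $P$ is $T_1$-prime if for all $x,y\in H$, $[G(x),G(y)]\subset P$ implies $x\in P$ or $y\in P$; it is $T_2$-prime if for all $x,y\in H$, $G(x)\cap G(y)\subset P$ implies $x\in P$ or $y\in P$. $Spec^i_G(H)$ is the set of $T_i$-prime ideals of $H$; for a normal subgroup $I$ of $H$, $V^i_H(I)$ is the set of $P\in Spec^i_G(H)$ with $I\subset P$. $Spec^i_G(H)$ carries the topology (the $T_i$-topology) whose closed sets are the sets $V^i_H(I)$, $I$ a normal subgroup of $H$. For $U$ open in $Spec^i_G(H)$, $rad^i_G(U)$ is the intersection of the elements of $U$; for $P\in Spec^i_G(H)$, $rad^i_G(P)$ is the subgroup of $H$ generated by the union of all $rad^i_G(U)$, where $U$ runs over the open subsets with $P\in U$. For $P\in Spec^i_G(H)$, $l_P:H\to H/P$ is the quotient map. The structural sheaf $O^i_H$: for $U$ open in $Spec^i_G(H)$, $O^i_H(U)$ is the group (under pointwise multiplication) of functions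 $s:U\to\bigcup_{P\in U}H/P$ such that $s(P)\in H/P$ for every $P\in U$, and such that there exist an open cover $(U_j)_{j}$ of $U$ and elements $h_j\in H$ with $s(P)=l_P(h_j)$ for every $P\in U_j$. *)

theory Defs
  imports "HOL-Analysis.Abstract_Topology" "HOL-Algebra.Generated_Groups" "HOL-Algebra.Product_Groups"
begin

text \<open>A \<open>G\<close>-group is a pair \<open>(H, f)\<close> with \<^prop>\<open>group_hom G H f\<close>. The index \<open>i\<close> below is meant
  to range over \<open>{1, 2}\<close>.\<close>

definition orbit_subgroup ::
    "('g, 'c) monoid_scheme \<Rightarrow> ('a, 'b) monoid_scheme \<Rightarrow> ('g \<Rightarrow> 'a) \<Rightarrow> 'a \<Rightarrow> 'a set" where
  "orbit_subgroup G H f x = generate H {f g \<otimes>\<^bsub>H\<^esub> x \<otimes>\<^bsub>H\<^esub> inv\<^bsub>H\<^esub> (f g) | g. g \<in> carrier G}"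

definition commutator_subgroup :: "('a, 'b) monoid_scheme \<Rightarrow> 'a set \<Rightarrow> 'a set \<Rightarrow> 'a set" where
  "commutator_subgroup H L L' =
     generate H {l \<otimes>\<^bsub>H\<^esub> l' \<otimes>\<^bsub>H\<^esub> inv\<^bsub>H\<^esub> l \<otimes>\<^bsub>H\<^esub> inv\<^bsub>H\<^esub> l' | l l'. l \<in> L \<and> l' \<in> L'}"

definition group_ideal :: "('a, 'b) monoid_scheme \<Rightarrow> 'a set \<Rightarrow> bool" where
  "group_ideal H P \<longleftrightarrow> P \<lhd> H \<and> P \<noteq> carrier H"

definition T1_prime ::
    "('g, 'c) monoid_scheme \<Rightarrow> ('a, 'b) monoid_scheme \<Rightarrow> ('g \<Rightarrow> 'a) \<Rightarrow> 'a set \<Rightarrow> bool" where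
  "T1_prime G H f P \<longleftrightarrow> group_ideal H P \<and>
     (\<forall>x\<in>carrier H. \<forall>y\<in>carrier H.
        commutator_subgroup H (orbit_subgroup G H f x) (orbit_subgroup G H f y) \<subseteq> P
          \<longrightarrow> x \<in> P \<or> y \<in> P)"

definition T2_prime ::
    "('g, 'c) monoid_scheme \<Rightarrow> ('a, 'b) monoid_scheme \<Rightarrow> ('g \<Rightarrow> 'a) \<Rightarrow> 'a set \<Rightarrow> bool" where
  "T2_prime G H f P \<longleftrightarrow> group_ideal H P \<and>
     (\<forall>x\<in>carrier H. \<forall>y\<in>carrier H.
        orbit_subgroup G H f x \<inter> orbit_subgroup G H f y \<subseteq> P \<longrightarrow> x \<in> P \<or> y \<in> P)"

definition Spec ::
    "nat \<Rightarrow> ('g, 'c) monoid_scheme \<Rightarrow> ('a, 'b) monoid_scheme \<Rightarrow> ('g \<Rightarrow> 'a) \<Rightarrow> 'a set set" where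
  "Spec i G H f = {P. if i = 1 then T1_prime G H f P else T2_prime G H f P}"

definition Vset ::
    "nat \<Rightarrow> ('g, 'c) monoid_scheme \<Rightarrow> ('a, 'b) monoid_scheme \<Rightarrow> ('g \<Rightarrow> 'a) \<Rightarrow> 'a set \<Rightarrow> 'a set set" where
  "Vset i G H f I = {P \<in> Spec i G H f. I \<subseteq> P}"

definition T_topology ::
    "nat \<Rightarrow> ('g, 'c) monoid_scheme \<Rightarrow> ('a, 'b) monoid_scheme \<Rightarrow> ('g \<Rightarrow> 'a) \<Rightarrow> 'a set topology" where
  "T_topology i G H f = topology (\<lambda>U. \<exists>I. I \<lhd> H \<and> U = Spec i G H f - Vset i G H f I)"

text \<open>The intersection with \<^term>\<open>carrier H\<close> only matters for empty \<open>U\<close>.\<close>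

definition rad_open :: "('a, 'b) monoid_scheme \<Rightarrow> 'a set set \<Rightarrow> 'a set" where
  "rad_open H U = carrier H \<inter> \<Inter>U"

definition rad ::
    "nat \<Rightarrow> ('g, 'c) monoid_scheme \<Rightarrow> ('a, 'b) monoid_scheme \<Rightarrow> ('g \<Rightarrow> 'a) \<Rightarrow> 'a set \<Rightarrow> 'a set" where
  "rad i G H f P =
     generate H (\<Union>{rad_open H U | U. openin (T_topology i G H f) U \<and> P \<in> U})"

text \<open>Sections are extensional functions on \<open>U\<close>, so that equality of sections is equality of
  functions. The coset \<open>P #>\<^bsub>H\<^esub> h\<close> is the image of \<open>h\<close> under the quotient map to \<open>H Mod P\<close>.
  An open cover is given as a set of open sets rather than as an indexed family; repeated members
  of a family can be dropped, so this is no restriction.\<close>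

definition sections ::
    "nat \<Rightarrow> ('g, 'c) monoid_scheme \<Rightarrow> ('a, 'b) monoid_scheme \<Rightarrow> ('g \<Rightarrow> 'a) \<Rightarrow> 'a set set
       \<Rightarrow> ('a set \<Rightarrow> 'a set) set" where
  "sections i G H f U = {s \<in> (\<Pi>\<^sub>E P\<in>U. carrier (H Mod P)).
     \<exists>\<C> h. (\<forall>V\<in>\<C>. openin (T_topology i G H f) V) \<and> \<Union>\<C> = U \<and>
       (\<forall>V\<in>\<C>. h V \<in> carrier H \<and> (\<forall>P\<in>V. s P = P #>\<^bsub>H\<^esub> h V))}"

definition struct_sheaf ::
    "nat \<Rightarrow> ('g, 'c) monoid_scheme \<Rightarrow> ('a, 'b) monoid_scheme \<Rightarrow> ('g \<Rightarrow> 'a) \<Rightarrow> 'a set set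
       \<Rightarrow> ('a set \<Rightarrow> 'a set) monoid" where
  "struct_sheaf i G H f U =
     (product_group U (\<lambda>P. H Mod P))\<lparr>carrier := sections i G H f U\<rparr>"

text \<open>The stalk at \<open>x\<close> of a sheaf \<open>F\<close> of groups of (extensional) functions on \<open>X\<close>, with restriction
  of functions as restriction maps: the colimit of the groups \<open>F U\<close> over the open neighbourhoods
  \<open>U\<close> of \<open>x\<close>.\<close>

definition open_nhds :: "'p topology \<Rightarrow> 'p \<Rightarrow> 'p set set" where
  "open_nhds X x = {U. openin X U \<and> x \<in> U}"

definition local_sections ::
    "'p topology \<Rightarrow> ('p set \<Rightarrow> ('p \<Rightarrow> 'v) monoid) \<Rightarrow> 'p \<Rightarrow> ('p set \<times> ('p \<Rightarrow> 'v)) set" where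
  "local_sections X F x = (SIGMA U:open_nhds X x. carrier (F U))"

definition germ_rel ::
    "'p topology \<Rightarrow> ('p set \<Rightarrow> ('p \<Rightarrow> 'v) monoid) \<Rightarrow> 'p \<Rightarrow> ('p set \<times> ('p \<Rightarrow> 'v)) rel" where
  "germ_rel X F x = {((U, s), (V, t)). (U, s) \<in> local_sections X F x \<and> (V, t) \<in> local_sections X F x \<and>
     (\<exists>W\<in>open_nhds X x. W \<subseteq> U \<inter> V \<and> restrict s W = restrict t W)}"

text \<open>Two germs are multiplied by restricting representatives to a common neighbourhood; the union
  over all representatives is the usual way to lift an operation to a quotient
  (\<open>UN_equiv_class2\<close>).\<close>

definition stalk ::
    "'p topology \<Rightarrow> ('p set \<Rightarrow> ('p \<Rightarrow> 'v) monoid) \<Rightarrow> 'p \<Rightarrow> ('p set \<times> ('p \<Rightarrow> 'v)) set monoid" where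
  "stalk X F x =
     \<lparr>carrier = local_sections X F x // germ_rel X F x,
      monoid.mult = (\<lambda>A B. \<Union>(U, s)\<in>A. \<Union>(V, t)\<in>B.
        germ_rel X F x `` {(U \<inter> V, restrict s (U \<inter> V) \<otimes>\<^bsub>F (U \<inter> V)\<^esub> restrict t (U \<inter> V))}),
      one = germ_rel X F x `` {(topspace X, \<one>\<^bsub>F (topspace X)\<^esub>)}\<rparr>"

text \<open>The sets \<open>Spec - V(I)\<close> do form a topology, so that \<^const>\<open>T_topology\<close> is not
  a vacuous use of \<^const>\<open>topology\<close>.\<close>

lemma Spec_normal: "P \<in> Spec i G H f \<Longrightarrow> P \<lhd> H"
  by (auto simp: Spec_def T1_prime_def T2_prime_def group_ideal_def split: if_splits)

lemma orbit_subgroup_subset: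
  assumes "group_hom G H f" "I \<lhd> H" "x \<in> I"
  shows "orbit_subgroup G H f x \<subseteq> I"
proof -
  interpret group_hom G H f by fact
  interpret I: normal I H by fact
  show ?thesis
    unfolding orbit_subgroup_def
    using assms(3) by (intro H.generate_subgroup_incl I.subgroup_axioms) (blast intro: I.inv_op_closed2 hom_closed)
qed

lemma commutator_subgroup_subset:
  assumes "I \<lhd> H" "J \<lhd> H" "L \<subseteq> I" "M \<subseteq> J"
  shows "commutator_subgroup H L M \<subseteq> I \<inter> J"
proof -
  interpret I: normal I H by fact
  interpret J: normal J H by fact
  have "l \<otimes>\<^bsub>H\<^esub> m \<otimes>\<^bsub>H\<^esub> inv\<^bsub>H\<^esub> l \<otimes>\<^bsub>H\<^esub> inv\<^bsub>H\<^esub> m \<in> I \<inter> J" if "l \<in> L" "m \<in> M" for l m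
  proof -
    have l: "l \<in> I" "l \<in> carrier H" and m: "m \<in> J" "m \<in> carrier H"
      using that assms I.subset J.subset by auto
    have "m \<otimes>\<^bsub>H\<^esub> inv\<^bsub>H\<^esub> l \<otimes>\<^bsub>H\<^esub> inv\<^bsub>H\<^esub> m \<in> I"
      using l m by (blast intro: I.inv_op_closed2 subgroup.m_inv_closed[OF I.subgroup_axioms])
    then have "l \<otimes>\<^bsub>H\<^esub> (m \<otimes>\<^bsub>H\<^esub> inv\<^bsub>H\<^esub> l \<otimes>\<^bsub>H\<^esub> inv\<^bsub>H\<^esub> m) \<in> I"
      using l by (blast intro: subgroup.m_closed[OF I.subgroup_axioms])
    moreover have "(l \<otimes>\<^bsub>H\<^esub> m \<otimes>\<^bsub>H\<^esub> inv\<^bsub>H\<^esub> l) \<otimes>\<^bsub>H\<^esub> inv\<^bsub>H\<^esub> m \<in> J"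
      using l m by (blast intro: subgroup.m_closed[OF J.subgroup_axioms] J.inv_op_closed2
        subgroup.m_inv_closed[OF J.subgroup_axioms])
    ultimately show ?thesis using l m by (simp add: I.m_assoc)
  qed
  then show ?thesis
    unfolding commutator_subgroup_def
    by (intro I.generate_subgroup_incl I.subgroups_Inter_pair I.subgroup_axioms J.subgroup_axioms) blast
qed

lemma Vset_Int:
  assumes "group_hom G H f" "I \<lhd> H" "J \<lhd> H"
  shows "Vset i G H f (I \<inter> J) = Vset i G H f I \<union> Vset i G H f J"
proof -
  have "I \<subseteq> P \<or> J \<subseteq> P" if P: "P \<in> Spec i G H f" and IJ: "I \<inter> J \<subseteq> P" for P
  proof (rule ccontr)
    assume "\<not> (I \<subseteq> P \<or> J \<subseteq> P)"
    then obtain x y where x: "x \<in> I" "x \<notin> P" and y: "y \<in> J" "y \<notin> P" by blast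
    have c: "x \<in> carrier H" "y \<in> carrier H"
      using x y assms by (meson normal_imp_subgroup subgroup.mem_carrier)+
    have o: "orbit_subgroup G H f x \<subseteq> I" "orbit_subgroup G H f y \<subseteq> J"
      using x y assms orbit_subgroup_subset by metis+
    have "orbit_subgroup G H f x \<inter> orbit_subgroup G H f y \<subseteq> P"
      "commutator_subgroup H (orbit_subgroup G H f x) (orbit_subgroup G H f y) \<subseteq> P"
      using o IJ commutator_subgroup_subset[OF assms(2,3) o] by blast+
    with P c x y show False
      unfolding Spec_def T1_prime_def T2_prime_def by (auto split: if_splits)
  qed
  then show ?thesis by (auto simp: Vset_def)
qed

lemma generate_Union_normal:
  assumes "group H" "\<And>I. I \<in> \<I> \<Longrightarrow> I \<lhd> H"
  shows "generate H (\<Union>\<I>) \<lhd> H"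
proof -
  interpret group H by fact
  show ?thesis
  proof (rule normal_generateI)
    show "\<Union>\<I> \<subseteq> carrier H"
      using assms(2) normal_imp_subgroup subgroup.subset by blast
    show "g \<otimes>\<^bsub>H\<^esub> h \<otimes>\<^bsub>H\<^esub> inv\<^bsub>H\<^esub> g \<in> \<Union>\<I>" if "h \<in> \<Union>\<I>" "g \<in> carrier H" for h g
      using that assms(2) normal.inv_op_closed2 by (metis Union_iff)
  qed
qed

lemma istopology_T:
  assumes "group_hom G H f"
  shows "istopology (\<lambda>U. \<exists>I. I \<lhd> H \<and> U = Spec i G H f - Vset i G H f I)"
  unfolding istopology_def
proof (intro conjI allI impI)
  interpret group_hom G H f by fact
  fix S T
  assume "\<exists>I. I \<lhd> H \<and> S = Spec i G H f - Vset i G H f I"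
    "\<exists>I. I \<lhd> H \<and> T = Spec i G H f - Vset i G H f I"
  then obtain I J where IJ: "I \<lhd> H" "S = Spec i G H f - Vset i G H f I"
    "J \<lhd> H" "T = Spec i G H f - Vset i G H f J" by blast
  then have "S \<inter> T = Spec i G H f - Vset i G H f (I \<inter> J)"
    by (auto simp: Vset_Int[OF assms])
  then show "\<exists>I. I \<lhd> H \<and> S \<inter> T = Spec i G H f - Vset i G H f I"
    using H.normal_subgroup_intersect[OF IJ(1,3)] by blast
next
  interpret group_hom G H f by fact
  fix K
  assume "\<forall>U\<in>K. \<exists>I. I \<lhd> H \<and> U = Spec i G H f - Vset i G H f I"
  then have K: "\<exists>I. I \<lhd> H \<and> U = Spec i G H f - Vset i G H f I" if "U \<in> K" for U
    using that by blast
  define \<I> where "\<I> = {I. I \<lhd> H \<and> Spec i G H f - Vset i G H f I \<in> K}"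
  have N: "generate H (\<Union>\<I>) \<lhd> H"
    by (rule generate_Union_normal[OF H.group_axioms]) (simp add: \<I>_def)
  have gen: "generate H (\<Union>\<I>) \<subseteq> P \<longleftrightarrow> (\<forall>I\<in>\<I>. I \<subseteq> P)" if "P \<in> Spec i G H f" for P
  proof
    assume "\<forall>I\<in>\<I>. I \<subseteq> P"
    then have "\<Union>\<I> \<subseteq> P" by blast
    then show "generate H (\<Union>\<I>) \<subseteq> P"
      using normal_imp_subgroup[OF Spec_normal[OF that]] by (rule H.generate_subgroup_incl)
  next
    assume "generate H (\<Union>\<I>) \<subseteq> P"
    moreover have "\<Union>\<I> \<subseteq> generate H (\<Union>\<I>)"
      by (blast intro: generate.incl)
    ultimately show "\<forall>I\<in>\<I>. I \<subseteq> P" by blast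
  qed
  have "\<Union>K = (\<Union>I\<in>\<I>. Spec i G H f - Vset i G H f I)"
  proof
    show "\<Union>K \<subseteq> (\<Union>I\<in>\<I>. Spec i G H f - Vset i G H f I)"
    proof
      fix P assume "P \<in> \<Union>K"
      then obtain U where U: "U \<in> K" "P \<in> U" by blast
      from K[OF U(1)] obtain I where "I \<lhd> H" "U = Spec i G H f - Vset i G H f I" by blast
      with U have "I \<in> \<I>" "P \<in> Spec i G H f - Vset i G H f I"
        by (simp_all add: \<I>_def)
      then show "P \<in> (\<Union>I\<in>\<I>. Spec i G H f - Vset i G H f I)" by blast
    qed
  qed (auto simp: \<I>_def)
  also have "\<dots> = Spec i G H f - Vset i G H f (generate H (\<Union>\<I>))"
    unfolding Vset_def using gen by auto
  finally show "\<exists>I. I \<lhd> H \<and> \<Union>K = Spec i G H f - Vset i G H f I"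
    using N by blast
qed

lemma openin_T_topology:
  assumes "group_hom G H f"
  shows "openin (T_topology i G H f) U \<longleftrightarrow> (\<exists>I. I \<lhd> H \<and> U = Spec i G H f - Vset i G H f I)"
  unfolding T_topology_def by (simp add: topology_inverse'[OF istopology_T[OF assms]])

lemma topspace_T_topology:
  assumes "group_hom G H f"
  shows "topspace (T_topology i G H f) = Spec i G H f"
proof -
  interpret group_hom G H f by fact
  have "Vset i G H f (carrier H) = {}"
  proof (rule equals0I)
    fix P assume "P \<in> Vset i G H f (carrier H)"
    then have "group_ideal H P" "carrier H \<subseteq> P"
      by (auto simp: Vset_def Spec_def T1_prime_def T2_prime_def split: if_splits)
    then show False
      using normal_imp_subgroup subgroup.subset unfolding group_ideal_def by blast
  qed
  moreover have "carrier H \<lhd> H"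
    by (simp add: H.normal_inv_iff H.subgroup_self)
  ultimately have "openin (T_topology i G H f) (Spec i G H f)"
    unfolding openin_T_topology[OF assms] by blast
  then show ?thesis
    unfolding topspace_def using openin_T_topology[OF assms] by blast
qed

lemma rad_normal:
  assumes "group_hom G H f"
  shows "rad i G H f P \<lhd> H"
  unfolding rad_def
proof (rule generate_Union_normal)
  interpret group_hom G H f by fact
  show "group H" by (rule H.group_axioms)
  fix I assume "I \<in> {rad_open H U | U. openin (T_topology i G H f) U \<and> P \<in> U}"
  then obtain U where U: "openin (T_topology i G H f) U" and I: "I = carrier H \<inter> \<Inter>U"
    by (auto simp: rad_open_def)
  have n: "Q \<lhd> H" if "Q \<in> U" for Q
    using openin_subset[OF U] that Spec_normal unfolding topspace_T_topology[OF assms] by blast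
  have "subgroup (\<Inter>(insert (carrier H) U)) H"
    by (rule H.subgroups_Inter) (use n in \<open>auto simp: H.subgroup_self normal_imp_subgroup\<close>)
  then show "I \<lhd> H"
    unfolding H.normal_inv_iff I using n by (auto intro: normal.inv_op_closed2)
qed

end

theory Submission
  imports Defs
begin

text \<open>
  Every \<open>h \<in> H\<close> defines a global section of the structural sheaf, namely \<open>Q \<mapsto> l\<^sub>Q(h)\<close>. Taking
  its germ at \<open>P\<close> gives a homomorphism \<open>\<gamma>\<close> from \<open>H\<close> to the stalk. It is onto
  because a section is, by definition of the sheaf, locally of the form \<open>Q \<mapsto> l\<^sub>Q(h)\<close>
  (\<open>germ_at_image\<close>). If \<open>P\<close> has an open neighbourhood \<open>U\<close> such that \<open>h\<close> lies in every \<open>Q \<in> U\<close>,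
  then \<open>l\<^sub>Q(h)\<close> is trivial for all \<open>Q \<in> U\<close>, so \<open>\<gamma>(h)\<close> is trivial. The kernel of \<open>\<gamma>\<close> is a
  subgroup, so as it contains these generators of \<open>rad(P)\<close> it contains all of \<open>rad(P)\<close>
  (\<open>rad_subset_kernel_germ_at\<close>), and \<open>\<gamma>\<close> factors through a surjection from \<open>H/rad(P)\<close> onto
  the stalk. The first isomorphism theorem finishes the proof.

  The one point that needs care is that germs can be multiplied representative by
  representative (\<open>stalk_mult_germ\<close>): the product of two sections is again locally given by elements
  of \<open>H\<close>, which is most easily seen after restating the covering condition on sections as a
  condition at each point (\<open>sections_iff_locally\<close>).
\<close>

section \<open>Germs\<close>

lemma open_nhds_Int:
  "U \<in> open_nhds X x \<Longrightarrow> V \<in> open_nhds X x \<Longrightarrow> U \<inter> V \<in> open_nhds X x"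
  by (auto simp: open_nhds_def)

lemma germ_relI:
  assumes "(U, s) \<in> local_sections X F x" "(V, t) \<in> local_sections X F x"
    and "W \<in> open_nhds X x" "W \<subseteq> U \<inter> V" "\<And>y. y \<in> W \<Longrightarrow> s y = t y"
  shows "((U, s), (V, t)) \<in> germ_rel X F x"
proof -
  have "restrict s W = restrict t W"
    using assms(5) by (rule restrict_ext)
  with assms show ?thesis unfolding germ_rel_def by blast
qed

lemma germ_relE:
  assumes "((U, s), (V, t)) \<in> germ_rel X F x"
  obtains W where "W \<in> open_nhds X x" "W \<subseteq> U \<inter> V" "\<forall>y\<in>W. s y = t y"
proof -
  obtain W where W: "W \<in> open_nhds X x" "W \<subseteq> U \<inter> V" "restrict s W = restrict t W"
    using assms unfolding germ_rel_def by blast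
  have "\<forall>y\<in>W. s y = t y"
    using W(3) by (metis restrict_apply')
  with W(1,2) show thesis by (rule that)
qed

lemma germ_rel_local_sections:
  assumes "((U, s), (V, t)) \<in> germ_rel X F x"
  shows "(U, s) \<in> local_sections X F x" "(V, t) \<in> local_sections X F x"
  using assms by (auto simp: germ_rel_def)

lemma equiv_germ_rel: "equiv (local_sections X F x) (germ_rel X F x)"
proof (rule equivI)
  show "germ_rel X F x \<subseteq> local_sections X F x \<times> local_sections X F x"
    by (auto simp: germ_rel_def)
  show "refl_on (local_sections X F x) (germ_rel X F x)"
    by (rule refl_onI) (auto simp: germ_rel_def local_sections_def)
  show "sym (germ_rel X F x)"
    by (rule symI, clarify, rule germ_relE, assumption, rule germ_relI)
      (auto dest: germ_rel_local_sections)
  show "trans (germ_rel X F x)"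
  proof (rule transI, clarify)
    fix U s V t W u
    assume 1: "((U, s), (V, t)) \<in> germ_rel X F x" and 2: "((V, t), (W, u)) \<in> germ_rel X F x"
    obtain A where A: "A \<in> open_nhds X x" "A \<subseteq> U \<inter> V" "\<forall>y\<in>A. s y = t y"
      by (rule germ_relE[OF 1])
    obtain B where B: "B \<in> open_nhds X x" "B \<subseteq> V \<inter> W" "\<forall>y\<in>B. t y = u y"
      by (rule germ_relE[OF 2])
    show "((U, s), (W, u)) \<in> germ_rel X F x"
    proof (rule germ_relI)
      show "A \<inter> B \<in> open_nhds X x" using A(1) B(1) by (rule open_nhds_Int)
    qed (use A B germ_rel_local_sections[OF 1] germ_rel_local_sections[OF 2] in auto)
  qed
qed

section \<open>Surjective homomorphisms factoring through a quotient\<close>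

text \<open>Since \<open>N\<close> is killed by \<open>h\<close>, the map \<open>h\<close> descends to \<open>G/N\<close>; the subgroup \<open>M\<close> is the kernel of
  the descended map, which is still onto.\<close>

lemma surj_hom_iso_quotient_of_quotient:
  assumes "group_hom G K h" "N \<lhd> G" "N \<subseteq> kernel G K h" "h ` carrier G = carrier K"
  shows "\<exists>M. M \<lhd> (G Mod N) \<and> K \<cong> (G Mod N) Mod M"
proof -
  interpret group_hom G K h by fact
  obtain g where g: "g \<in> hom (G Mod N) K" "\<And>x. x \<in> carrier G \<Longrightarrow> g (N #>\<^bsub>G\<^esub> x) = h x"
    using FactGroup_universal_kernel[OF assms(2,3)] by blast
  have grp: "group (G Mod N)"
    using assms(2) by (rule normal.factorgroup_is_group)
  interpret g: group_hom "G Mod N" K g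
    using g(1) grp H.group_axioms by (simp add: group_hom_def group_hom_axioms_def)
  have "g ` carrier (G Mod N) = carrier K"
    using g(2) assms(4) by (auto simp: carrier_FactGroup image_image)
  then have "(G Mod N) Mod kernel (G Mod N) K g \<cong> K"
    by (rule g.FactGroup_iso)
  then have "K \<cong> (G Mod N) Mod kernel (G Mod N) K g"
    by (rule group.iso_sym[OF normal.factorgroup_is_group[OF g.normal_kernel]])
  then show ?thesis
    using g.normal_kernel by blast
qed

section \<open>Sections and stalks of the structural sheaf\<close>

locale G_group_spectrum = group_hom G H f
  for G :: "('g, 'c) monoid_scheme" and H :: "('a, 'b) monoid_scheme" (structure) and f +
  fixes i :: nat
begin

abbreviation "X \<equiv> T_topology i G H f"

abbreviation "F \<equiv> struct_sheaf i G H f"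

abbreviation "germ P U s \<equiv> germ_rel X F P `` {(U, s)}"

definition element_section :: "'a set set \<Rightarrow> 'a \<Rightarrow> 'a set \<Rightarrow> 'a set" where
  "element_section U h = (\<lambda>Q\<in>U. Q #> h)"

definition germ_at :: "'a set \<Rightarrow> 'a \<Rightarrow> ('a set set \<times> ('a set \<Rightarrow> 'a set)) set" where
  "germ_at P h = germ P (topspace X) (element_section (topspace X) h)"

lemma open_normal: "openin X U \<Longrightarrow> Q \<in> U \<Longrightarrow> Q \<lhd> H"
  using openin_subset[of X U] Spec_normal
  unfolding topspace_T_topology[OF group_hom_axioms] by blast

text \<open>Restriction and multiplication of sections refine the covers that witness membership
  in the sheaf; the pointwise form of the condition spares the choice of an element of
  \<open>H\<close> for every member of the refined cover.\<close>

lemma sections_iff_locally: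
  "s \<in> sections i G H f U \<longleftrightarrow> openin X U \<and> s \<in> extensional U \<and>
     (\<forall>Q\<in>U. \<exists>V h. openin X V \<and> Q \<in> V \<and> V \<subseteq> U \<and> h \<in> carrier H \<and> (\<forall>R\<in>V. s R = R #> h))"
    (is "?lhs \<longleftrightarrow> ?rhs")
proof
  assume ?lhs
  then obtain \<C> h where s: "s \<in> (\<Pi>\<^sub>E Q\<in>U. carrier (H Mod Q))"
    and \<C>: "\<forall>V\<in>\<C>. openin X V" "\<Union>\<C> = U"
    and h: "\<forall>V\<in>\<C>. h V \<in> carrier H \<and> (\<forall>R\<in>V. s R = R #> h V)"
    unfolding sections_def mem_Collect_eq by (elim conjE exE) (rule that)
  have "openin X U" using \<C> by blast
  moreover have "s \<in> extensional U" using s by (simp add: PiE_iff)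
  moreover have "\<exists>V h. openin X V \<and> Q \<in> V \<and> V \<subseteq> U \<and> h \<in> carrier H \<and> (\<forall>R\<in>V. s R = R #> h)"
    if "Q \<in> U" for Q
    using that \<C> h by (metis UnionE Union_upper)
  ultimately show ?rhs by blast
next
  assume ?rhs
  then have U: "openin X U" and ext: "s \<in> extensional U"
    and loc: "\<And>Q. Q \<in> U \<Longrightarrow>
      \<exists>V h. openin X V \<and> Q \<in> V \<and> V \<subseteq> U \<and> h \<in> carrier H \<and> (\<forall>R\<in>V. s R = R #> h)"
    by blast+
  define \<C> where "\<C> = {V. openin X V \<and> V \<subseteq> U \<and> (\<exists>h\<in>carrier H. \<forall>R\<in>V. s R = R #> h)}"
  have "\<forall>V\<in>\<C>. \<exists>h. h \<in> carrier H \<and> (\<forall>R\<in>V. s R = R #> h)"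
    unfolding \<C>_def by blast
  then obtain h where h: "\<forall>V\<in>\<C>. h V \<in> carrier H \<and> (\<forall>R\<in>V. s R = R #> h V)"
    by (rule bchoice[THEN exE])
  have cov: "\<Union>\<C> = U"
  proof
    show "\<Union>\<C> \<subseteq> U" by (auto simp: \<C>_def)
    show "U \<subseteq> \<Union>\<C>"
    proof
      fix Q assume "Q \<in> U"
      from loc[OF this] obtain V k where "openin X V" "Q \<in> V" "V \<subseteq> U"
        "k \<in> carrier H" "\<forall>R\<in>V. s R = R #> k" by blast
      then have "V \<in> \<C>" "Q \<in> V" by (auto simp: \<C>_def)
      then show "Q \<in> \<Union>\<C>" by blast
    qed
  qed
  have "s \<in> (\<Pi>\<^sub>E Q\<in>U. carrier (H Mod Q))"
    unfolding PiE_iff carrier_FactGroup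
  proof (intro conjI ballI ext)
    fix Q assume "Q \<in> U"
    from loc[OF this] show "s Q \<in> (\<lambda>x. Q #> x) ` carrier H" by blast
  qed
  moreover have "\<forall>V\<in>\<C>. openin X V" by (simp add: \<C>_def)
  ultimately show ?lhs
    using cov h unfolding sections_def mem_Collect_eq by (intro conjI exI[of _ \<C>] exI[of _ h])
qed

lemma local_sections_iff:
  "(U, s) \<in> local_sections X F P \<longleftrightarrow> openin X U \<and> P \<in> U \<and> s \<in> sections i G H f U"
  by (auto simp: local_sections_def struct_sheaf_def open_nhds_def)

lemma mult_struct_sheaf:
  "s \<otimes>\<^bsub>F U\<^esub> t = (\<lambda>Q\<in>U. s Q <#> t Q)"
  by (simp add: struct_sheaf_def)

lemma one_struct_sheaf: "openin X U \<Longrightarrow> \<one>\<^bsub>F U\<^esub> = element_section U \<one>"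
  unfolding struct_sheaf_def element_section_def
  by (auto intro!: restrict_ext simp: normal_imp_subgroup[THEN subgroup.subset] open_normal)

lemma element_section_in_sections:
  assumes "openin X U" "h \<in> carrier H"
  shows "element_section U h \<in> sections i G H f U"
  using assms unfolding sections_iff_locally element_section_def by auto

lemma mult_sections:
  assumes "s \<in> sections i G H f U" "t \<in> sections i G H f V"
  shows "restrict s (U \<inter> V) \<otimes>\<^bsub>F (U \<inter> V)\<^esub> restrict t (U \<inter> V) \<in> sections i G H f (U \<inter> V)"
    (is "?p \<in> _")
  unfolding sections_iff_locally[of ?p]
proof (intro conjI ballI)
  show "openin X (U \<inter> V)"
    using assms unfolding sections_iff_locally by blast
  show "?p \<in> extensional (U \<inter> V)"
    by (simp add: mult_struct_sheaf)
  fix Q assume Q: "Q \<in> U \<inter> V"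
  obtain A h where A: "openin X A" "Q \<in> A" "A \<subseteq> U" "h \<in> carrier H" "\<forall>R\<in>A. s R = R #> h"
    using assms(1) Q unfolding sections_iff_locally by blast
  obtain B k where B: "openin X B" "Q \<in> B" "B \<subseteq> V" "k \<in> carrier H" "\<forall>R\<in>B. t R = R #> k"
    using assms(2) Q unfolding sections_iff_locally by blast
  have "?p R = R #> (h \<otimes> k)" if "R \<in> A \<inter> B" for R
  proof -
    have "R \<lhd> H" using that A(1) open_normal by blast
    then show ?thesis
      using that A B normal.rcos_sum[of R H h k] by (auto simp: mult_struct_sheaf)
  qed
  moreover have "openin X (A \<inter> B)" "Q \<in> A \<inter> B" "A \<inter> B \<subseteq> U \<inter> V" "h \<otimes> k \<in> carrier H"
    using A B by auto
  ultimately show "\<exists>W h. openin X W \<and> Q \<in> W \<and> W \<subseteq> U \<inter> V \<and> h \<in> carrier H \<and> (\<forall>R\<in>W. ?p R = R #> h)"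
    by blast
qed

text \<open>If \<open>s\<close> and \<open>s'\<close> agree on a neighbourhood \<open>A\<close> of \<open>P\<close>, and \<open>t\<close> and \<open>t'\<close> on \<open>B\<close>, then the
  products, being computed pointwise, agree on \<open>A \<inter> B\<close>. So the union in the definition of the
  product of germs ranges over a constant family.\<close>

lemma stalk_mult_germ:
  assumes "(U, s) \<in> local_sections X F P" "(V, t) \<in> local_sections X F P"
  shows "germ P U s \<otimes>\<^bsub>stalk X F P\<^esub> germ P V t =
    germ P (U \<inter> V) (restrict s (U \<inter> V) \<otimes>\<^bsub>F (U \<inter> V)\<^esub> restrict t (U \<inter> V))"
proof -
  let ?m = "\<lambda>(U, s) (V, t). germ P (U \<inter> V) (restrict s (U \<inter> V) \<otimes>\<^bsub>F (U \<inter> V)\<^esub> restrict t (U \<inter> V))"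
  have "?m (U, s) (V, t) = ?m (U', s') (V', t')"
    if 1: "((U, s), (U', s')) \<in> germ_rel X F P" and 2: "((V, t), (V', t')) \<in> germ_rel X F P"
    for U s U' s' V t V' t'
  proof -
    obtain A where A: "A \<in> open_nhds X P" "A \<subseteq> U \<inter> U'" "\<forall>y\<in>A. s y = s' y"
      by (rule germ_relE[OF 1])
    obtain B where B: "B \<in> open_nhds X P" "B \<subseteq> V \<inter> V'" "\<forall>y\<in>B. t y = t' y"
      by (rule germ_relE[OF 2])
    note ls = germ_rel_local_sections[OF 1] germ_rel_local_sections[OF 2]
    have "((U \<inter> V, restrict s (U \<inter> V) \<otimes>\<^bsub>F (U \<inter> V)\<^esub> restrict t (U \<inter> V)),
           (U' \<inter> V', restrict s' (U' \<inter> V') \<otimes>\<^bsub>F (U' \<inter> V')\<^esub> restrict t' (U' \<inter> V')))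
         \<in> germ_rel X F P"
    proof (rule germ_relI)
      show "A \<inter> B \<in> open_nhds X P" using A(1) B(1) by (rule open_nhds_Int)
      show "A \<inter> B \<subseteq> U \<inter> V \<inter> (U' \<inter> V')" using A(2) B(2) by blast
    qed (use A B ls mult_sections in \<open>auto simp: local_sections_iff mult_struct_sheaf\<close>)
    then show ?thesis
      unfolding prod.case by (rule equiv_class_eq[OF equiv_germ_rel])
  qed
  then have "congruent2 (germ_rel X F P) (germ_rel X F P) ?m"
    unfolding congruent2_def by fast
  from UN_equiv_class2[OF equiv_germ_rel equiv_germ_rel this assms]
  show ?thesis
    by (simp add: stalk_def case_prod_unfold)
qed

section \<open>The homomorphism from the group to the stalk\<close>

context
  fixes P
  assumes P: "P \<in> Spec i G H f"
begin

lemma element_section_local: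
  "h \<in> carrier H \<Longrightarrow> (topspace X, element_section (topspace X) h) \<in> local_sections X F P"
  using P topspace_T_topology[OF group_hom_axioms, of i]
  unfolding local_sections_iff by (blast intro: element_section_in_sections openin_topspace)

lemma germ_at_mult:
  assumes "h \<in> carrier H" "k \<in> carrier H"
  shows "germ_at P (h \<otimes> k) = germ_at P h \<otimes>\<^bsub>stalk X F P\<^esub> germ_at P k"
proof -
  have "element_section U h \<otimes>\<^bsub>F U\<^esub> element_section U k = element_section U (h \<otimes> k)"
    if "openin X U" for U
    using assms that normal.rcos_sum[OF open_normal]
    by (auto simp: mult_struct_sheaf element_section_def intro!: restrict_ext)
  moreover have "restrict (element_section U h') U = element_section U h'" for U h'
    by (simp add: element_section_def)
  ultimately show ?thesis
    using assms by (simp add: germ_at_def stalk_mult_germ element_section_local)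
qed

text \<open>Near \<open>P\<close>, every section agrees with the section of a single element of \<open>H\<close>, which
  extends to the whole spectrum; so each germ is the germ of a global section of this kind.\<close>

lemma germ_at_image: "germ_at P ` carrier H = carrier (stalk X F P)"
proof
  show "germ_at P ` carrier H \<subseteq> carrier (stalk X F P)"
    by (auto simp: stalk_def germ_at_def intro!: quotientI element_section_local)
  show "carrier (stalk X F P) \<subseteq> germ_at P ` carrier H"
  proof
    fix A assume "A \<in> carrier (stalk X F P)"
    then obtain U s where A: "A = germ P U s" and ls: "(U, s) \<in> local_sections X F P"
      by (auto simp: stalk_def elim!: quotientE)
    then obtain V h where V: "openin X V" "P \<in> V" "V \<subseteq> U" and h: "h \<in> carrier H"
      and s: "\<forall>R\<in>V. s R = R #> h"
      unfolding local_sections_iff sections_iff_locally by blast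
    have "((U, s), (topspace X, element_section (topspace X) h)) \<in> germ_rel X F P"
    proof (rule germ_relI[OF ls element_section_local[OF h]])
      show "V \<in> open_nhds X P" using V by (simp add: open_nhds_def)
      show "V \<subseteq> U \<inter> topspace X" using V openin_subset by blast
      then show "s R = element_section (topspace X) h R" if "R \<in> V" for R
        using s that by (auto simp: element_section_def)
    qed
    then have "A = germ_at P h"
      unfolding A germ_at_def by (rule equiv_class_eq[OF equiv_germ_rel])
    with h show "A \<in> germ_at P ` carrier H" by blast
  qed
qed

lemma germ_at_one: "germ_at P \<one> = \<one>\<^bsub>stalk X F P\<^esub>"
  by (simp add: germ_at_def stalk_def one_struct_sheaf)

text \<open>The group axioms of the stalk are inherited from \<open>H\<close> along the surjection \<^const>\<open>germ_at\<close>.\<close>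

lemma group_hom_germ_at: "group_hom H (stalk X F P) (germ_at P)"
proof -
  have hom: "germ_at P \<in> hom H (stalk X F P)"
    using germ_at_image by (auto simp: hom_def germ_at_mult)
  have "group (stalk X F P)"
    using H.hom_imp_img_group[OF hom] by (simp add: germ_at_image germ_at_one)
  with hom show ?thesis
    by (simp add: group_hom_def group_hom_axioms_def)
qed

text \<open>It is enough to treat the generators of the radical. If \<open>h\<close> belongs to every \<open>Q \<in> U\<close>, then the
  sections of \<open>h\<close> and of \<open>\<one>\<close> coincide on \<open>U\<close>, hence have the same germ at each point of \<open>U\<close>.\<close>

lemma rad_subset_kernel_germ_at:
  "rad i G H f P \<subseteq> kernel H (stalk X F P) (germ_at P)"
  unfolding rad_def
proof (rule H.generate_subgroup_incl)
  show "subgroup (kernel H (stalk X F P) (germ_at P)) H"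
    using group_hom_germ_at by (rule group_hom.subgroup_kernel)
  show "\<Union>{rad_open H U | U. openin X U \<and> P \<in> U} \<subseteq> kernel H (stalk X F P) (germ_at P)"
  proof clarify
    fix h U assume U: "openin X U" "P \<in> U" and "h \<in> rad_open H U"
    then have h: "h \<in> carrier H" and hQ: "\<And>Q. Q \<in> U \<Longrightarrow> h \<in> Q"
      by (auto simp: rad_open_def)
    have "((topspace X, element_section (topspace X) h), (topspace X, element_section (topspace X) \<one>))
        \<in> germ_rel X F P"
    proof (rule germ_relI)
      show "U \<in> open_nhds X P" using U by (simp add: open_nhds_def)
      show U_top: "U \<subseteq> topspace X \<inter> topspace X" using openin_subset[OF U(1)] by blast
      fix Q assume Q: "Q \<in> U"
      then have "subgroup Q H"
        using U(1) open_normal normal_imp_subgroup by blast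
      then have "Q #> h = Q #> \<one>"
        using h hQ[OF Q] H.coset_join2 subgroup.one_closed by (metis H.one_closed)
      then show "element_section (topspace X) h Q = element_section (topspace X) \<one> Q"
        using Q U_top by (auto simp: element_section_def)
    qed (use h element_section_local in auto)
    then have "germ_at P h = germ_at P \<one>"
      unfolding germ_at_def by (rule equiv_class_eq[OF equiv_germ_rel])
    with h show "h \<in> kernel H (stalk X F P) (germ_at P)"
      by (simp add: kernel_def germ_at_one)
  qed
qed

end

end

theorem proposition4p1:
  fixes G :: "('g, 'c) monoid_scheme" and H :: "('a, 'b) monoid_scheme"
    and f :: "'g \<Rightarrow> 'a" and i :: nat and P :: "'a set"
  assumes "group_hom G H f" and "i \<in> {1, 2}" and "P \<in> Spec i G H f"
  shows "\<exists>N. N \<lhd> (H Mod rad i G H f P) \<and>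
    stalk (T_topology i G H f) (struct_sheaf i G H f) P \<cong> (H Mod rad i G H f P) Mod N"
proof -
  interpret G_group_spectrum G H f i
    using assms(1) by (simp add: G_group_spectrum_def)
  show ?thesis
    using group_hom_germ_at[OF assms(3)] rad_normal[OF assms(1)]
      rad_subset_kernel_germ_at[OF assms(3)] germ_at_image[OF assms(3)]
    by (rule surj_hom_iso_quotient_of_quotient)
qed

end
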